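(* For every finite unichain MDP $\langle \mathcal S,\mathcal A,\mathcal P,\bm r\rangle$ and every $\beta\ge 0$, the iterative algorithm described in the context terminates after a finite number of iterations (that is, the set $\mathbb Y$ becomes empty after finitely many iterations), and upon termination its output is a global optimum of the mean-variance optimization problem: the returned policy $d_{\rm out}\in\mathcal D$ and value $\eta_{\rm out}$ satisfy $\eta_{\rm out}=\beta\sigma^{d_{\rm out}}-\mu^{d_{\rm out}}=\min_{d\in\mathcal D}\{\beta\sigma^d-\mu^d\}$.
   Context: MDP setting. $\mathcal S=\{1,\dots,S\}$ is a finite state space, $\mathcal A$ is a finite nonempty action space, $p(j|i,a)$ is the probability of moving from state $i$ to state $j$ under action $a$, and $r(i,a)\in\mathbb R$ is the reward. $\mathcal D$ is the (finite) set of stationary deterministic policies $d:\mathcal S\to\mathcal A$. For $d\in\mathcal D$, $\bm P^d$ is the $S\times S$ transition matrix with entries $p(j|i,d(i))$. Standing assumption: for every $d\in\mathcal D$ the Markov chain with matrix $\bm P^d$ is a unichain (a single recurrent class plus possibly transient states), so it has a unique stationary distribution $\bm\pi^d=(\pi^d(i))_{i\in\mathcal S}$, with $\bm\pi^d\bm P^d=\bm\pi^d$ and $\sum_i\pi^d(i)=1$. Long-run mean: $\mu^d=\sum_{i\in\mathcal S}\pi^d(i)\,r(i,d(i))$. Long-run (steady-state) variance: $\sigma^d=\sum_{i\in\mathcal S}\pi^d(i)\,(r(i,d(i))-\mu^d)^2$ (note that $\sigma^d$ denotes the variance itself). Pseudo variance with pseudo mean $y\in\mathbb R$: $\tilde\sigma^d(y)=\sum_{i\in\mathcal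 S}\pi^d(i)\,(r(i,d(i))-y)^2$. For fixed $y$, $\mathcal M(y)$ denotes the problem $\min_{d\in\mathcal D}\{\beta\tilde\sigma^d(y)-\mu^d\}$. Put $\underline r=\min_{i,a}r(i,a)$ and $\overline r=\max_{i,a}r(i,a)$. Algorithm. Initialize $\mathbb Y=[\underline r,\overline r]$, $l=0$, and $\eta_{\rm out}=+\infty$. While $\mathbb Y\neq\varnothing$, perform one iteration: 1. Write $\mathbb Y$ as the disjoint union of its maximal intervals (connected components, possibly single points), sorted in descending order along the real line as $\mathbb Y_1,\mathbb Y_2,\dots$, and set $y_l=(\sup\mathbb Y_1+\inf\mathbb Y_1)/2$. 2. Solve $\mathcal M(y_l)$, obtaining some optimal policy $\tilde d_l\in\mathcal D$ of $\mathcal M(y_l)$ (any optimal policy may be returned). 3. Replace $\mathbb Y$ by $\mathbb Y\setminus\big[\,y_l-|y_l-\mu^{\tilde d_l}|,\ y_l+|y_l-\mu^{\tilde d_l}|\,\big]$. 4. If $\eta_{\rm out}>\beta\sigma^{\tilde d_l}-\mu^{\tilde d_l}$, set $\eta_{\rm out}=\beta\sigma^{\tilde d_l}-\mu^{\tilde d_l}$ and $d_{\rm out}=\tilde d_l$. 5. Set $l:=l+1$. When $\mathbb Y=\varnothing$, return $d_{\rm out}$ and $\eta_{\rm out}$. *)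

theory Defs
  imports "HOL-Probability.Probability"
begin

section \<open>Finite Markov chains\<close>

definition mat_power :: "real^'s^'s \<Rightarrow> nat \<Rightarrow> real^'s^'s" where
  "mat_power P n = (((**) P) ^^ n) (mat 1)"

definition accessible :: "real^'s^'s \<Rightarrow> 's \<Rightarrow> 's \<Rightarrow> bool" where
  "accessible P i j \<longleftrightarrow> (\<exists>n. mat_power P n $ i $ j > 0)"

definition communicates :: "real^'s^'s \<Rightarrow> 's \<Rightarrow> 's \<Rightarrow> bool" where
  "communicates P i j \<longleftrightarrow> accessible P i j \<and> accessible P j i"

text \<open>\<open>first_passage P n i j\<close> is the probability that the chain started in \<open>i\<close> visits \<open>j\<close> at
  time \<open>n\<close> and at none of the times \<open>1, \<dots>, n - 1\<close>; the value at time 0 is 0 by convention.\<close>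

fun first_passage :: "real^'s^'s \<Rightarrow> nat \<Rightarrow> 's \<Rightarrow> 's \<Rightarrow> real" where
  "first_passage P 0 i j = 0"
| "first_passage P (Suc 0) i j = P $ i $ j"
| "first_passage P (Suc (Suc n)) i j = (\<Sum>k\<in>UNIV - {j}. P $ i $ k * first_passage P (Suc n) k j)"

text \<open>A state is recurrent if the chain returns to it with probability one; otherwise it is
  transient.\<close>

definition recurrent :: "real^'s^'s \<Rightarrow> 's \<Rightarrow> bool" where
  "recurrent P i \<longleftrightarrow> (\<lambda>n. first_passage P n i i) sums 1"

definition recurrent_class :: "real^'s^'s \<Rightarrow> 's set \<Rightarrow> bool" where
  "recurrent_class P C \<longleftrightarrow> (\<exists>i. recurrent P i \<and> C = {j. communicates P i j})"

definition unichain :: "real^'s^'s \<Rightarrow> bool" where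
  "unichain P \<longleftrightarrow> (\<exists>!C. recurrent_class P C)"

definition stationary_distribution :: "real^'s^'s \<Rightarrow> real^'s \<Rightarrow> bool" where
  "stationary_distribution P x \<longleftrightarrow> (\<forall>i. 0 \<le> x $ i) \<and> (\<Sum>i\<in>UNIV. x $ i) = 1 \<and> x v* P = x"


section \<open>Markov decision processes\<close>

text \<open>The probability \<open>p(j|i,a)\<close> is \<open>pmf (K i a) j\<close>. States and actions are the elements of the
  finite types \<open>'s\<close> and \<open>'a\<close>, so the type \<open>('s, 'a) policy\<close> is finite as well.\<close>

type_synonym ('s, 'a) kernel = "'s \<Rightarrow> 'a \<Rightarrow> 's pmf"
type_synonym ('s, 'a) policy = "'s \<Rightarrow> 'a"

definition trans_matrix :: "('s::finite, 'a) kernel \<Rightarrow> ('s, 'a) policy \<Rightarrow> real^'s^'s" where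
  "trans_matrix K d = (\<chi> i j. pmf (K i (d i)) j)"

definition unichain_mdp :: "('s::finite, 'a::finite) kernel \<Rightarrow> bool" where
  "unichain_mdp K \<longleftrightarrow> (\<forall>d. unichain (trans_matrix K d))"

text \<open>Meaningful for unichain policies, whose stationary distribution exists and is unique.\<close>

definition stat_dist :: "('s::finite, 'a) kernel \<Rightarrow> ('s, 'a) policy \<Rightarrow> real^'s" where
  "stat_dist K d = (THE x. stationary_distribution (trans_matrix K d) x)"

definition long_run_mean ::
  "('s::finite, 'a) kernel \<Rightarrow> ('s \<Rightarrow> 'a \<Rightarrow> real) \<Rightarrow> ('s, 'a) policy \<Rightarrow> real" where
  "long_run_mean K r d = (\<Sum>i\<in>UNIV. stat_dist K d $ i * r i (d i))"

definition pseudo_variance ::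
  "('s::finite, 'a) kernel \<Rightarrow> ('s \<Rightarrow> 'a \<Rightarrow> real) \<Rightarrow> real \<Rightarrow> ('s, 'a) policy \<Rightarrow> real" where
  "pseudo_variance K r y d = (\<Sum>i\<in>UNIV. stat_dist K d $ i * (r i (d i) - y)\<^sup>2)"

definition long_run_variance ::
  "('s::finite, 'a) kernel \<Rightarrow> ('s \<Rightarrow> 'a \<Rightarrow> real) \<Rightarrow> ('s, 'a) policy \<Rightarrow> real" where
  "long_run_variance K r d = (\<Sum>i\<in>UNIV. stat_dist K d $ i * (r i (d i) - long_run_mean K r d)\<^sup>2)"

definition mv_objective ::
  "('s::finite, 'a) kernel \<Rightarrow> ('s \<Rightarrow> 'a \<Rightarrow> real) \<Rightarrow> real \<Rightarrow> ('s, 'a) policy \<Rightarrow> real" where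
  "mv_objective K r \<beta> d = \<beta> * long_run_variance K r d - long_run_mean K r d"

definition pseudo_optimal ::
  "('s::finite, 'a) kernel \<Rightarrow> ('s \<Rightarrow> 'a \<Rightarrow> real) \<Rightarrow> real \<Rightarrow> real \<Rightarrow> ('s, 'a) policy \<Rightarrow> bool" where
  "pseudo_optimal K r \<beta> y d \<longleftrightarrow>
     is_arg_min (\<lambda>d'. \<beta> * pseudo_variance K r y d' - long_run_mean K r d') (\<lambda>_. True) d"

definition min_reward :: "('s::finite \<Rightarrow> 'a::finite \<Rightarrow> real) \<Rightarrow> real" where
  "min_reward r = Min (range (\<lambda>(i, a). r i a))"

definition max_reward :: "('s::finite \<Rightarrow> 'a::finite \<Rightarrow> real) \<Rightarrow> real" where
  "max_reward r = Max (range (\<lambda>(i, a). r i a))"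


section \<open>The algorithm\<close>

text \<open>The algorithm is a nondeterministic transition relation on program states, because the
  subproblem solver may return any optimal policy. \<open>None\<close> means that no policy is stored yet.\<close>

record ('s, 'a) alg_state =
  cand :: "real set"
  iter :: nat
  eta_out :: ereal
  d_out :: "('s, 'a) policy option"

definition init_state :: "('s::finite \<Rightarrow> 'a::finite \<Rightarrow> real) \<Rightarrow> ('s, 'a) alg_state" where
  "init_state r =
     \<lparr>cand = {min_reward r..max_reward r}, iter = 0, eta_out = \<infinity>, d_out = None\<rparr>"

definition top_component :: "real set \<Rightarrow> real set \<Rightarrow> bool" where
  "top_component Y C \<longleftrightarrow>
     C \<in> components Y \<and> (\<forall>C'\<in>components Y. C' \<noteq> C \<longrightarrow> (\<forall>x\<in>C'. \<forall>z\<in>C. x < z))"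

definition update ::
  "('s::finite, 'a::finite) kernel \<Rightarrow> ('s \<Rightarrow> 'a \<Rightarrow> real) \<Rightarrow> real \<Rightarrow> real \<Rightarrow> ('s, 'a) policy \<Rightarrow>
   ('s, 'a) alg_state \<Rightarrow> ('s, 'a) alg_state" where
  "update K r \<beta> y d s =
     (let \<delta> = \<bar>y - long_run_mean K r d\<bar>;
          v = ereal (mv_objective K r \<beta> d)
      in \<lparr>cand = cand s - {y - \<delta>..y + \<delta>},
          iter = iter s + 1,
          eta_out = (if eta_out s > v then v else eta_out s),
          d_out = (if eta_out s > v then Some d else d_out s)\<rparr>)"

definition alg_step ::
  "('s::finite, 'a::finite) kernel \<Rightarrow> ('s \<Rightarrow> 'a \<Rightarrow> real) \<Rightarrow> real \<Rightarrow>
   ('s, 'a) alg_state \<Rightarrow> ('s, 'a) alg_state \<Rightarrow> bool" where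
  "alg_step K r \<beta> s s' \<longleftrightarrow>
     cand s \<noteq> {} \<and>
     (\<exists>C y d. top_component (cand s) C \<and> y = (Sup C + Inf C) / 2 \<and>
        pseudo_optimal K r \<beta> y d \<and> s' = update K r \<beta> y d s)"

end

theory Submission
  imports Defs
begin

text \<open>
  The proof rests on the identity that the pseudo variance of a policy with mean \<open>\<mu>\<close> at the
  pseudo mean \<open>y\<close> exceeds its variance by \<open>(y - \<mu>)\<^sup>2\<close>.  Hence if \<open>d\<close> is optimal for the
  subproblem at \<open>y\<close> and the mean of \<open>d'\<close> is at most as far from \<open>y\<close> as the mean of \<open>d\<close>, then
  \<open>d\<close> is at least as good as \<open>d'\<close> for the mean-variance objective
  (\<open>pseudo_optimal_dominates\<close>).  The interval deleted in an iteration consists of exactly the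
  values that are so close to \<open>y\<close>, so a policy whose mean is deleted is no better than the incumbent.
  All means start inside the candidate set because a mean is a convex combination of rewards;
  once the candidate set is empty, the incumbent is therefore optimal (\<open>sound_final\<close>).

  Termination follows from a lexicographic measure: first the number of policy means still in the
  candidate set, then the number of its components (\<open>progress_step\<close>).  The returned mean \<open>\<mu>\<close> is
  an endpoint of the deleted closed interval.  If \<open>\<mu>\<close> was still a candidate, the first
  coordinate drops.  If not, \<open>\<mu>\<close> lies outside the top component, and a closed interval centred at
  the midpoint of that component and reaching a point outside it swallows the component
  entirely; everything else is only truncated from above, so the number of components drops.

  Both arguments need that the stationary distribution attached to a policy really is one, that
  is, that a finite unichain has exactly one.  Existence is Brouwer's theorem on the probability
  simplex.  For uniqueness, the positive and the negative part of the difference of two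
  stationary distributions are both invariant, and each of them lives on a set of states that is
  closed under accessibility and consists of recurrent states.  Two different stationary
  distributions would thus produce two disjoint recurrent classes.
\<close>

section \<open>Stationary distributions of a stochastic matrix\<close>

definition stochastic :: "real^'s^'s::finite \<Rightarrow> bool" where
  "stochastic P \<longleftrightarrow> (\<forall>i j. 0 \<le> P $ i $ j) \<and> (\<forall>i. (\<Sum>j\<in>UNIV. P $ i $ j) = 1)"

lemma stochastic_trans_matrix:
  fixes K :: "('s::finite, 'a) kernel"
  shows "stochastic (trans_matrix K d)"
  unfolding stochastic_def trans_matrix_def
  by (simp add: sum_pmf_eq_1)

lemma vector_matrix_nth: "(x v* P) $ j = (\<Sum>i\<in>UNIV. x $ i * P $ i $ j)"
  for x :: "real^'s::finite" and P :: "real^'s^'s"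
  by (simp add: vector_matrix_mult_def mult.commute)

lemma sum_vector_stochastic:
  fixes x :: "real^'s::finite"
  assumes "stochastic P"
  shows "(\<Sum>j\<in>UNIV. (x v* P) $ j) = (\<Sum>i\<in>UNIV. x $ i)"
proof -
  have "(\<Sum>j\<in>UNIV. (x v* P) $ j) = (\<Sum>i\<in>UNIV. \<Sum>j\<in>UNIV. x $ i * P $ i $ j)"
    unfolding vector_matrix_nth by (rule sum.swap)
  also have "\<dots> = (\<Sum>i\<in>UNIV. x $ i)"
    using assms by (simp add: stochastic_def flip: sum_distrib_left)
  finally show ?thesis .
qed

lemma stationary_distribution_exists:
  fixes P :: "real^'s^'s::finite"
  assumes "stochastic P"
  shows "\<exists>x. stationary_distribution P x"
proof -
  let ?S = "{x :: real^'s. (\<forall>i. 0 \<le> x $ i) \<and> (\<Sum>i\<in>UNIV. x $ i) = 1}"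
  have "closed ?S"
    by (intro closed_Collect_conj closed_Collect_all closed_Collect_le closed_Collect_eq
        continuous_intros)
  moreover have "bounded ?S"
  proof (rule boundedI)
    fix x :: "real^'s" assume "x \<in> ?S"
    then show "norm x \<le> 1" using norm_le_l1_cart[of x] by simp
  qed
  ultimately have "compact ?S" by (simp add: compact_eq_bounded_closed)
  moreover have "convex ?S"
    by (auto simp: convex_def sum.distrib simp flip: sum_distrib_left)
  moreover have "axis undefined 1 \<in> ?S"
    by (auto simp: axis_def)
  then have "?S \<noteq> {}" by blast
  moreover have "continuous_on ?S (\<lambda>x. x v* P)"
    unfolding vector_matrix_mult_def by (intro continuous_intros)
  moreover have "(\<lambda>x. x v* P) \<in> ?S \<rightarrow> ?S"
    using assms sum_vector_stochastic[OF assms]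
    by (auto simp: vector_matrix_nth stochastic_def intro!: sum_nonneg)
  ultimately obtain x where "x \<in> ?S" "x v* P = x"
    by (rule brouwer)
  then show ?thesis by (auto simp: stationary_distribution_def)
qed

lemma first_passage_nonneg:
  assumes "stochastic P"
  shows "0 \<le> first_passage P n k j"
  using assms
  by (induction P n k j rule: first_passage.induct) (auto simp: stochastic_def intro!: sum_nonneg mult_nonneg_nonneg)

text \<open>First-step analysis of the probability of a visit to \<open>j\<close> by time \<open>N + 1\<close>.\<close>

lemma sum_first_passage_Suc:
  "(\<Sum>n<Suc (Suc N). first_passage P n k j)
     = P $ k $ j + (\<Sum>l\<in>UNIV - {j}. P $ k $ l * (\<Sum>n<Suc N. first_passage P n l j))"
proof (induction N)
  case 0
  then show ?case by simp
next
  case (Suc N)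
  have "(\<Sum>n<Suc (Suc (Suc N)). first_passage P n k j)
    = (\<Sum>n<Suc (Suc N). first_passage P n k j) + first_passage P (Suc (Suc N)) k j" by simp
  also have "\<dots> = P $ k $ j + (\<Sum>l\<in>UNIV - {j}. P $ k $ l * (\<Sum>n<Suc N. first_passage P n l j)
      + P $ k $ l * first_passage P (Suc N) l j)"
    unfolding Suc by (simp add: sum.distrib)
  finally show ?case by (simp add: distrib_left)
qed

lemma sum_first_passage_le_1:
  fixes P :: "real^'s^'s::finite"
  assumes "stochastic P"
  shows "(\<Sum>n<Suc N. first_passage P n k j) \<le> 1"
proof (induction N arbitrary: k)
  case 0
  then show ?case by simp
next
  case (Suc N)
  have "(\<Sum>n<Suc (Suc N). first_passage P n k j)
    \<le> P $ k $ j + (\<Sum>l\<in>UNIV - {j}. P $ k $ l * 1)"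
    unfolding sum_first_passage_Suc using assms Suc
    by (intro add_left_mono sum_mono mult_left_mono) (auto simp: stochastic_def)
  also have "\<dots> = (\<Sum>l\<in>UNIV. P $ k $ l)"
    by (simp add: sum.remove[of UNIV j])
  also have "\<dots> = 1" using assms by (simp add: stochastic_def)
  finally show ?case .
qed

text \<open>Let \<open>h k\<close> be the probability that the chain started in \<open>k\<close> ever visits \<open>j\<close> at a positive
  time, and let \<open>h'\<close> agree with \<open>h\<close> except that \<open>h' j = 1\<close>.  First-step analysis says
  \<open>h = P h'\<close>, so invariance gives \<open>w \<cdot> h = (w P) \<cdot> h' = w \<cdot> h'\<close>.  The two sides differ only in
  the term of \<open>j\<close>, whence \<open>w j * h j = w j\<close> and \<open>h j = 1\<close>.\<close>

lemma recurrent_if_invariant_pos: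
  fixes P :: "real^'s^'s::finite"
  assumes P: "stochastic P" and w: "w v* P = w" and pos: "w $ j > 0"
  shows "recurrent P j"
proof -
  define h where "h k = (\<Sum>n. first_passage P n k j)" for k
  have summable: "summable (\<lambda>n. first_passage P n k j)" for k
  proof (rule bounded_imp_summable[where B = 1])
    fix n
    show "(\<Sum>m\<le>n. first_passage P m k j) \<le> 1"
      using sum_first_passage_le_1[OF P, where N = n] by (simp only: lessThan_Suc_atMost)
  qed (rule first_passage_nonneg[OF P])
  have lim: "(\<lambda>N. \<Sum>n<N. first_passage P n k j) \<longlonglongrightarrow> h k" for k
    using summable_LIMSEQ[OF summable] by (simp add: h_def)
  have first_step: "h k = P $ k $ j + (\<Sum>l\<in>UNIV - {j}. P $ k $ l * h l)" for k
  proof (rule LIMSEQ_unique)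
    show "(\<lambda>N. \<Sum>n<Suc (Suc N). first_passage P n k j) \<longlonglongrightarrow> h k"
      by (rule LIMSEQ_Suc[OF LIMSEQ_Suc[OF lim]])
    show "(\<lambda>N. \<Sum>n<Suc (Suc N). first_passage P n k j)
            \<longlonglongrightarrow> P $ k $ j + (\<Sum>l\<in>UNIV - {j}. P $ k $ l * h l)"
      unfolding sum_first_passage_Suc by (intro tendsto_intros LIMSEQ_Suc[OF lim])
  qed
  define h' where "h' k = (if k = j then 1 else h k)" for k
  have h: "h k = (\<Sum>l\<in>UNIV. P $ k $ l * h' l)" for k
    using first_step[of k] by (simp add: sum.remove[of UNIV j] h'_def)
  have "(\<Sum>k\<in>UNIV. w $ k * h k) = (\<Sum>l\<in>UNIV. \<Sum>k\<in>UNIV. w $ k * P $ k $ l * h' l)"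
    unfolding h sum_distrib_left by (subst sum.swap) (simp add: mult.assoc)
  also have "\<dots> = (\<Sum>l\<in>UNIV. w $ l * h' l)"
    by (subst (2) w[symmetric]) (simp add: vector_matrix_nth sum_distrib_right)
  finally have "w $ j * h j = w $ j"
    by (simp add: sum.remove[of UNIV j] h'_def)
  then have "h j = 1" using pos by simp
  then show ?thesis
    using summable_sums[OF summable, of j] by (simp add: recurrent_def h_def)
qed

lemma mat_power_nonneg:
  assumes "stochastic P"
  shows "0 \<le> mat_power P n $ i $ j"
proof (induction n arbitrary: i j)
  case 0
  then show ?case by (simp add: mat_power_def mat_def)
next
  case (Suc n)
  then show ?case using assms
    by (auto simp: mat_power_def matrix_matrix_mult_def stochastic_def intro!: sum_nonneg)
qed

lemma invariant_mat_power:
  fixes P :: "real^'s^'s::finite"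
  assumes "w v* P = w"
  shows "w v* mat_power P n = w"
  by (induction n) (simp_all add: mat_power_def assms flip: vector_matrix_mul_assoc)

text \<open>Mass at \<open>i\<close> is carried to \<open>j\<close> by some power of \<open>P\<close>, which leaves \<open>w\<close> unchanged.\<close>

lemma invariant_pos_closed:
  fixes P :: "real^'s^'s::finite"
  assumes P: "stochastic P" and w: "w v* P = w" "\<And>i. 0 \<le> w $ i"
    and i: "w $ i > 0" and acc: "accessible P i j"
  shows "w $ j > 0"
proof -
  obtain n where n: "mat_power P n $ i $ j > 0" using acc by (auto simp: accessible_def)
  have "0 < w $ i * mat_power P n $ i $ j" using i n by simp
  also have "\<dots> \<le> (\<Sum>k\<in>UNIV. w $ k * mat_power P n $ k $ j)"
    using w(2) mat_power_nonneg[OF P]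
    by (intro member_le_sum[where f = "\<lambda>k. w $ k * mat_power P n $ k $ j"]) auto
  also have "\<dots> = w $ j"
    using invariant_mat_power[OF w(1), of n] by (metis vector_matrix_nth)
  finally show ?thesis .
qed

lemma invariant_pos_recurrent_class:
  fixes P :: "real^'s^'s::finite"
  assumes "stochastic P" "w v* P = w" "\<And>i. 0 \<le> w $ i" "w $ i > 0"
  shows "\<exists>C. recurrent_class P C \<and> i \<in> C \<and> (\<forall>j\<in>C. w $ j > 0)"
proof (intro exI conjI)
  show "recurrent_class P {j. communicates P i j}"
    using recurrent_if_invariant_pos[OF assms(1,2,4)] by (auto simp: recurrent_class_def)
  have "accessible P i i"
    unfolding accessible_def by (rule exI[of _ 0]) (simp add: mat_power_def mat_def)
  then show "i \<in> {j. communicates P i j}" by (simp add: communicates_def)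
  show "\<forall>j\<in>{j. communicates P i j}. w $ j > 0"
    using invariant_pos_closed[OF assms] by (auto simp: communicates_def)
qed

text \<open>The positive part \<open>w\<close> of \<open>z\<close> satisfies \<open>w \<le> w P\<close> by monotonicity.  Since a stochastic
  matrix preserves total mass, no entry can grow strictly.\<close>

lemma invariant_positive_part:
  fixes P :: "real^'s^'s::finite"
  assumes P: "stochastic P" and z: "z v* P = z"
  shows "(\<chi> i. max 0 (z $ i)) v* P = (\<chi> i. max 0 (z $ i))"
proof -
  let ?w = "\<chi> i. max 0 (z $ i)"
  have le: "?w $ j \<le> (?w v* P) $ j" for j
  proof -
    have "z $ j \<le> (?w v* P) $ j"
      using P by (subst z[symmetric]) (auto simp: vector_matrix_nth stochastic_def
          intro!: sum_mono mult_right_mono)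
    moreover have "0 \<le> (?w v* P) $ j"
      using P by (auto simp: vector_matrix_nth stochastic_def intro!: sum_nonneg)
    ultimately show ?thesis by simp
  qed
  have "(?w v* P) $ j = ?w $ j" for j
  proof -
    have "(\<Sum>j\<in>UNIV. (?w v* P) $ j - ?w $ j) = 0"
      unfolding sum_subtractf sum_vector_stochastic[OF P] by simp
    then have "\<forall>j\<in>UNIV. (?w v* P) $ j - ?w $ j = 0"
      by (subst (asm) sum_nonneg_eq_0_iff) (use le in simp_all)
    then show ?thesis by simp
  qed
  then show ?thesis by (simp only: vec_eq_iff) simp
qed

text \<open>The difference of two distributions has total mass 0, so if it is nonzero it has entries of
  both signs.  The recurrent classes found where it is positive and where it is negative are
  disjoint and nonempty, whereas a unichain has only one class.\<close>

lemma stationary_distribution_unique: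
  fixes P :: "real^'s^'s::finite"
  assumes P: "stochastic P" and "unichain P"
    and x: "stationary_distribution P x" and y: "stationary_distribution P y"
  shows "x = y"
proof (rule ccontr)
  assume "x \<noteq> y"
  define z where "z = x - y"
  have z: "z v* P = z" and z': "(- z) v* P = - z"
    using x y unfolding stationary_distribution_def z_def vec_eq_iff vector_matrix_nth
    by (simp_all add: left_diff_distrib sum_subtractf)
  have sum: "(\<Sum>i\<in>UNIV. z $ i) = 0"
    using x y by (simp add: z_def stationary_distribution_def sum_subtractf)
  obtain k where k: "z $ k \<noteq> 0" using \<open>x \<noteq> y\<close> by (auto simp: z_def vec_eq_iff)
  have "\<exists>i. z $ i > 0"
  proof (rule ccontr)
    assume "\<nexists>i. z $ i > 0"
    then show False
      using sum_nonneg_eq_0_iff[of UNIV "\<lambda>i. - z $ i"] sum k by (auto simp: sum_negf not_less)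
  qed
  then obtain i where i: "z $ i > 0" by blast
  have "\<exists>j. z $ j < 0"
  proof (rule ccontr)
    assume "\<nexists>j. z $ j < 0"
    then show False
      using sum_nonneg_eq_0_iff[of UNIV "\<lambda>i. z $ i"] sum k by (auto simp: not_less)
  qed
  then obtain j where j: "z $ j < 0" by blast
  obtain C where C: "recurrent_class P C" "i \<in> C" "\<forall>j\<in>C. z $ j > 0"
    using invariant_pos_recurrent_class[OF P invariant_positive_part[OF P z], of i] i
    by (auto simp: less_max_iff_disj)
  obtain D where D: "recurrent_class P D" "j \<in> D" "\<forall>j\<in>D. z $ j < 0"
    using invariant_pos_recurrent_class[OF P invariant_positive_part[OF P z'], of j] j
    by (auto simp: less_max_iff_disj)
  have "C = D" using \<open>unichain P\<close> C(1) D(1) by (auto simp: unichain_def)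
  then show False using C(2,3) D(3) by fastforce
qed

lemma stationary_distribution_stat_dist:
  fixes K :: "('s::finite, 'a::finite) kernel"
  assumes "unichain_mdp K"
  shows "stationary_distribution (trans_matrix K d) (stat_dist K d)"
  unfolding stat_dist_def
proof (rule theI')
  show "\<exists>!x. stationary_distribution (trans_matrix K d) x"
    using stationary_distribution_exists stationary_distribution_unique
      stochastic_trans_matrix assms unfolding unichain_mdp_def by metis
qed


section \<open>Mean, variance and pseudo variance\<close>

lemma stat_dist_nonneg:
  assumes "unichain_mdp K"
  shows "0 \<le> stat_dist K d $ i"
  using stationary_distribution_stat_dist[OF assms] by (simp add: stationary_distribution_def)

lemma sum_stat_dist:
  assumes "unichain_mdp K"
  shows "(\<Sum>i\<in>UNIV. stat_dist K d $ i) = 1"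
  using stationary_distribution_stat_dist[OF assms] by (simp add: stationary_distribution_def)

text \<open>The shift identity for second moments; it needs the weights to sum to one.\<close>

lemma pseudo_variance_eq:
  assumes "unichain_mdp K"
  shows "pseudo_variance K r y d = long_run_variance K r d + (y - long_run_mean K r d)\<^sup>2"
proof -
  let ?\<pi> = "\<lambda>i. stat_dist K d $ i" and ?m = "long_run_mean K r d"
  have "pseudo_variance K r y d
    = (\<Sum>i\<in>UNIV. ?\<pi> i * (r i (d i) - ?m)\<^sup>2 + (2 * (?m - y)) * (?\<pi> i * r i (d i))
         + ((y - ?m)\<^sup>2 - 2 * (?m - y) * ?m) * ?\<pi> i)"
    unfolding pseudo_variance_def
    by (intro sum.cong refl) (simp add: power2_eq_square algebra_simps)
  also have "\<dots> = long_run_variance K r d + 2 * (?m - y) * ?m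
      + ((y - ?m)\<^sup>2 - 2 * (?m - y) * ?m)"
    unfolding sum.distrib sum_distrib_left[symmetric] sum_stat_dist[OF assms]
    by (simp add: long_run_variance_def long_run_mean_def)
  finally show ?thesis by simp
qed

lemma long_run_mean_bounds:
  assumes "unichain_mdp K"
  shows "long_run_mean K r d \<in> {min_reward r..max_reward r}"
proof -
  have r: "min_reward r \<le> r i a" "r i a \<le> max_reward r" for i a
    unfolding min_reward_def max_reward_def
    by (auto intro!: Min_le Max_ge image_eqI[of _ _ "(i, a)"])
  have "(\<Sum>i\<in>UNIV. stat_dist K d $ i * min_reward r) \<le> long_run_mean K r d"
    "long_run_mean K r d \<le> (\<Sum>i\<in>UNIV. stat_dist K d $ i * max_reward r)"
    unfolding long_run_mean_def using r stat_dist_nonneg[OF assms]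
    by (auto intro!: sum_mono mult_left_mono)
  then show ?thesis by (simp add: sum_stat_dist[OF assms] flip: sum_distrib_right)
qed

text \<open>Passing from the objective to the pseudo objective at \<open>y\<close> adds \<open>\<beta>\<close> times the squared
  distance of the mean from \<open>y\<close>.  The policy \<open>d'\<close> loses the comparison of pseudo objectives
  and is charged at most as much as \<open>d\<close>, so it also loses without the charge.\<close>

lemma pseudo_optimal_dominates:
  assumes K: "unichain_mdp K" and "\<beta> \<ge> 0" and opt: "pseudo_optimal K r \<beta> y d"
    and near: "\<bar>y - long_run_mean K r d'\<bar> \<le> \<bar>y - long_run_mean K r d\<bar>"
  shows "mv_objective K r \<beta> d \<le> mv_objective K r \<beta> d'"
proof -
  have "\<beta> * pseudo_variance K r y d - long_run_mean K r d
      \<le> \<beta> * pseudo_variance K r y d' - long_run_mean K r d'"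
    using opt unfolding pseudo_optimal_def is_arg_min_linorder by simp
  moreover have "\<beta> * (y - long_run_mean K r d')\<^sup>2 \<le> \<beta> * (y - long_run_mean K r d)\<^sup>2"
    using near \<open>\<beta> \<ge> 0\<close> by (intro mult_left_mono) (simp_all add: abs_le_square_iff)
  ultimately show ?thesis
    by (simp add: pseudo_variance_eq[OF K] mv_objective_def distrib_left)
qed

lemma pseudo_optimal_exists: "\<exists>d. pseudo_optimal K r \<beta> y d"
  for K :: "('s::finite, 'a::finite) kernel"
  unfolding pseudo_optimal_def using ex_is_arg_min_if_finite[of "UNIV :: ('s, 'a) policy set"] by simp


section \<open>Components of real sets\<close>

text \<open>A nonempty connected set lies in a single component, so every component is the one around
  some member of the cover.  This bounds the number of components after an interval has been cut
  out, without determining the new components.\<close>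

lemma components_card_le_cover:
  assumes "finite F" and "\<And>T. T \<in> F \<Longrightarrow> connected T" and "\<Union>F = Y"
  shows "finite (components Y)" and "card (components Y) \<le> card F"
proof -
  (* An empty member of the cover yields the empty set or an arbitrary component: harmless, as only
     a surjection from the cover is needed. *)
  let ?comp = "\<lambda>T. connected_component_set Y (SOME x. x \<in> T)"
  have sub: "components Y \<subseteq> ?comp ` F"
  proof
    fix D assume "D \<in> components Y"
    then obtain x where x: "x \<in> Y" "D = connected_component_set Y x"
      by (auto simp: components_def)
    then obtain T where T: "T \<in> F" "x \<in> T" using assms(3) by blast
    have "(SOME x. x \<in> T) \<in> T" using T(2) by (rule someI)
    then have "connected_component Y x (SOME x. x \<in> T)"
      using assms T by (auto simp: connected_component_def)
    then have "D = ?comp T" unfolding x(2) by (simp add: connected_component_eq)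
    then show "D \<in> ?comp ` F" using T(1) by blast
  qed
  show "finite (components Y)" using sub assms(1) finite_surj by blast
  show "card (components Y) \<le> card F" using sub assms(1) by (rule surj_card_le[rotated])
qed

lemma component_is_interval: "C \<in> components Y \<Longrightarrow> is_interval C"
  for Y :: "real set"
  by (simp add: is_interval_connected_1 in_components_connected)

lemma finite_components_diff_interval:
  fixes Y :: "real set"
  assumes "finite (components Y)"
  shows "finite (components (Y - {a..b}))"
proof (rule components_card_le_cover)
  let ?F = "(\<lambda>D. D \<inter> {..<a}) ` components Y \<union> (\<lambda>D. D \<inter> {b<..}) ` components Y"
  show "finite ?F" using assms by simp
  show "connected T" if "T \<in> ?F" for T
    using that by (auto simp flip: is_interval_connected_1 intro!: is_interval_Int
        dest: component_is_interval)
  have "\<Union>?F = \<Union>(components Y) - {a..b}" by auto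
  then show "\<Union>?F = Y - {a..b}" by simp
qed

text \<open>Disjoint intervals are ordered as their representatives are, so the component with the
  largest representative is the top one.\<close>

lemma top_component_exists:
  assumes "finite (components Y)" and "Y \<noteq> {}"
  shows "\<exists>C. top_component Y C"
proof -
  define f where "f C = (SOME x. x \<in> C)" for C :: "real set"
  have f: "f C \<in> C" if "C \<in> components Y" for C
    using in_components_nonempty[OF that] by (auto simp: f_def some_in_eq)
  have "components Y \<noteq> {}" using assms(2) by simp
  then have "Max (f ` components Y) \<in> f ` components Y"
    using assms(1) by (intro Max_in) auto
  then obtain C where C: "C \<in> components Y" and "f C = Max (f ` components Y)"
    by (metis imageE)
  then have max: "\<forall>C'\<in>components Y. f C' \<le> f C"
    using assms(1) by simp
  have "x < z" if C': "C' \<in> components Y" "C' \<noteq> C" and "x \<in> C'" "z \<in> C" for C' x z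
  proof (rule ccontr)
    assume "\<not> x < z"
    have disj: "u \<noteq> v" if "u \<in> C'" "v \<in> C" for u v
      using components_nonoverlap[OF C'(1) C] C'(2) that by blast
    have "z < x" using \<open>\<not> x < z\<close> disj[OF \<open>x \<in> C'\<close> \<open>z \<in> C\<close>] by simp
    have "f C' < f C" using max C' disj[OF f[OF C'(1)] f[OF C]] by (simp add: order_less_le)
    show False
    proof (cases "x \<le> f C")
      case True
      then have "x \<in> C"
        using component_is_interval[OF C] \<open>z \<in> C\<close> f[OF C] \<open>z < x\<close> unfolding is_interval_1
        by (meson less_imp_le)
      then show False using disj \<open>x \<in> C'\<close> by blast
    next
      case False
      then have "f C \<in> C'"
        using component_is_interval[OF C'(1)] \<open>x \<in> C'\<close> f[OF C'(1)] \<open>f C' < f C\<close>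
        unfolding is_interval_1 by (meson less_imp_le not_le)
      then show False using disj f[OF C] by blast
    qed
  qed
  then show ?thesis using C unfolding top_component_def by blast
qed

lemma between_Inf_Sup_in_interval:
  fixes C :: "real set"
  assumes "is_interval C" "C \<noteq> {}" "Inf C < x" "x < Sup C"
  shows "x \<in> C"
proof -
  obtain u where "u \<in> C" "u < x" using cInf_lessD[OF assms(2,3)] by blast
  moreover obtain v where "v \<in> C" "x < v" using less_cSupD[OF assms(2,4)] by blast
  ultimately show ?thesis using assms(1) unfolding is_interval_1 by (meson less_imp_le)
qed

text \<open>A point outside an interval is at least half its length away from its midpoint.\<close>

lemma interval_subset_if_outside:
  fixes C :: "real set"
  assumes "is_interval C" "bounded C" "m \<notin> C" and y: "y = (Sup C + Inf C) / 2"
  shows "C \<subseteq> {y - \<bar>y - m\<bar>..y + \<bar>y - m\<bar>}"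
proof
  fix x assume x: "x \<in> C"
  have bnd: "Inf C \<le> x" "x \<le> Sup C"
    using x assms(2) by (simp_all add: cInf_lower cSup_upper bounded_imp_bdd_below bounded_imp_bdd_above)
  have "m \<le> Inf C \<or> Sup C \<le> m"
    using between_Inf_Sup_in_interval[OF assms(1), of m] assms(3) x by force
  then show "x \<in> {y - \<bar>y - m\<bar>..y + \<bar>y - m\<bar>}"
    using bnd unfolding y by (auto simp: field_simps abs_if split: if_splits)
qed

text \<open>Nothing lies above the top component, so deleting an interval that contains it amounts to
  cutting the other components off at \<open>a\<close>, which cannot split any of them.\<close>

lemma card_components_diff_top_less:
  fixes Y :: "real set"
  assumes fin: "finite (components Y)" and top: "top_component Y C" and C: "C \<subseteq> {a..b}"
  shows "card (components (Y - {a..b})) < card (components Y)"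
proof -
  have C': "C \<in> components Y" using top by (simp add: top_component_def)
  obtain z where z: "z \<in> C" using in_components_nonempty[OF C'] by blast
  have below: "x \<le> b" if "x \<in> D" "D \<in> components Y" for x D
  proof (cases "D = C")
    case False
    then have "x < z" using top that z by (auto simp: top_component_def)
    also have "z \<le> b" using z C by auto
    finally show ?thesis by simp
  qed (use that C in auto)
  let ?F = "(\<lambda>D. D \<inter> {..<a}) ` (components Y - {C})"
  have "card (components (Y - {a..b})) \<le> card ?F"
  proof (rule components_card_le_cover)
    show "finite ?F" using fin by simp
    show "connected T" if "T \<in> ?F" for T
      using that by (auto simp flip: is_interval_connected_1 intro!: is_interval_Int
          dest: component_is_interval)
    have "\<Union>?F = (\<Union>D\<in>components Y - {C}. D - {a..b})"
      using below by force
    also have "\<dots> = \<Union>(components Y) - {a..b}" using C by blast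
    finally have "\<Union>?F = \<Union>(components Y) - {a..b}" .
    then show "\<Union>?F = Y - {a..b}" by simp
  qed
  also have "\<dots> \<le> card (components Y - {C})" using fin by (intro card_image_le) simp
  also have "\<dots> < card (components Y)" using fin C' by (rule card_Diff1_less)
  finally show ?thesis .
qed


section \<open>Termination and correctness of the algorithm\<close>

definition tame :: "real set \<Rightarrow> bool" where
  "tame Y \<longleftrightarrow> bounded Y \<and> finite (components Y)"

lemma tame_init: "tame (cand (init_state r))"
proof -
  have "finite (components {min_reward r..max_reward r})"
    by (rule components_card_le_cover(1)[of "{{min_reward r..max_reward r}}"]) auto
  then show ?thesis by (simp add: tame_def init_state_def)
qed

lemma tame_step:
  assumes "alg_step K r \<beta> s s'" "tame (cand s)"
  shows "tame (cand s')"
  using assms finite_components_diff_interval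
  by (auto simp: alg_step_def tame_def update_def Let_def intro: bounded_subset)

text \<open>An iteration that hits a remaining mean may split a component, so the number of components
  has to come second in the lexicographic order.\<close>

definition progress :: "('s::finite, 'a::finite) kernel \<Rightarrow> ('s \<Rightarrow> 'a \<Rightarrow> real) \<Rightarrow>
    ('s, 'a) alg_state \<Rightarrow> nat \<times> nat" where
  "progress K r s =
     (card (cand s \<inter> range (long_run_mean K r)), card (components (cand s)))"

text \<open>If the mean of the returned policy is still a candidate, it is deleted as an endpoint of the
  interval; this covers the degenerate interval \<open>{y}\<close>.  Otherwise it lies outside the top
  component, and the interval covers that component.\<close>

lemma progress_step:
  assumes step: "alg_step K r \<beta> s s'" and tame: "tame (cand s)"
  shows "(progress K r s', progress K r s) \<in> less_than <*lex*> less_than"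
proof -
  obtain C y d where top: "top_component (cand s) C" and y: "y = (Sup C + Inf C) / 2"
    and s': "s' = update K r \<beta> y d s"
    using step by (auto simp: alg_step_def)
  let ?m = "long_run_mean K r d"
  let ?I = "{y - \<bar>y - ?m\<bar>..y + \<bar>y - ?m\<bar>}" and ?M = "range (long_run_mean K r)"
  have cand': "cand s' = cand s - ?I" by (simp add: s' update_def Let_def)
  have C: "C \<in> components (cand s)" "C \<subseteq> cand s"
    using top in_components_subset by (auto simp: top_component_def)
  show ?thesis
  proof (cases "?m \<in> cand s")
    case True
    have "?m \<in> ?I" by (auto simp: abs_if)
    then have "cand s' \<inter> ?M \<subset> cand s \<inter> ?M" using True cand' by blast
    then have "card (cand s' \<inter> ?M) < card (cand s \<inter> ?M)" by (intro psubset_card_mono) auto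
    then show ?thesis by (simp add: progress_def)
  next
    case False
    have "bounded C" using C(2) tame bounded_subset by (auto simp: tame_def)
    then have "C \<subseteq> ?I"
      using False C(2) component_is_interval[OF C(1)] by (intro interval_subset_if_outside y) auto
    then have "card (components (cand s')) < card (components (cand s))"
      unfolding cand' using tame by (intro card_components_diff_top_less[OF _ top])
        (simp_all add: tame_def)
    moreover have "card (cand s' \<inter> ?M) \<le> card (cand s \<inter> ?M)"
      using cand' by (intro card_mono) auto
    ultimately show ?thesis by (auto simp: progress_def)
  qed
qed

text \<open>The loop invariant: the stored value belongs to the stored policy, and a policy whose mean
  has been deleted is no better than the stored value.\<close>

definition sound :: "('s::finite, 'a::finite) kernel \<Rightarrow> ('s \<Rightarrow> 'a \<Rightarrow> real) \<Rightarrow> real \<Rightarrow>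
    ('s, 'a) alg_state \<Rightarrow> bool" where
  "sound K r \<beta> s \<longleftrightarrow>
     eta_out s = (case d_out s of None \<Rightarrow> \<infinity> | Some d \<Rightarrow> ereal (mv_objective K r \<beta> d)) \<and>
     (\<forall>d. long_run_mean K r d \<in> cand s \<or> eta_out s \<le> ereal (mv_objective K r \<beta> d))"

lemma sound_init:
  assumes "unichain_mdp K"
  shows "sound K r \<beta> (init_state r)"
  using long_run_mean_bounds[OF assms] by (simp add: sound_def init_state_def)

lemma sound_step:
  assumes K: "unichain_mdp K" "\<beta> \<ge> 0" and step: "alg_step K r \<beta> s s'" and s: "sound K r \<beta> s"
  shows "sound K r \<beta> s'"
proof -
  obtain y d where opt: "pseudo_optimal K r \<beta> y d" and s': "s' = update K r \<beta> y d s"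
    using step by (auto simp: alg_step_def)
  have eta: "eta_out s' \<le> eta_out s" "eta_out s' \<le> ereal (mv_objective K r \<beta> d)"
    by (auto simp: s' update_def Let_def)
  have "eta_out s' \<le> ereal (mv_objective K r \<beta> d')" if "long_run_mean K r d' \<notin> cand s'" for d'
  proof (cases "long_run_mean K r d' \<in> cand s")
    case True
    then have "\<bar>y - long_run_mean K r d'\<bar> \<le> \<bar>y - long_run_mean K r d\<bar>"
      using that by (auto simp: s' update_def Let_def abs_le_iff)
    from pseudo_optimal_dominates[OF K opt this] show ?thesis
      using eta(2) by (meson ereal_less_eq(3) order_trans)
  next
    case False
    then show ?thesis using s eta(1) by (meson sound_def order_trans)
  qed
  moreover have "eta_out s' = (case d_out s' of None \<Rightarrow> \<infinity> | Some d \<Rightarrow> ereal (mv_objective K r \<beta> d))"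
    using s by (auto simp: s' sound_def update_def Let_def)
  ultimately show ?thesis unfolding sound_def by blast
qed

lemma reachable_tame:
  assumes "(alg_step K r \<beta>)\<^sup>*\<^sup>* (init_state r) s"
  shows "tame (cand s)"
  using assms by (induction rule: rtranclp_induct) (auto intro: tame_init tame_step)

lemma reachable_sound:
  assumes "unichain_mdp K" "\<beta> \<ge> 0" "(alg_step K r \<beta>)\<^sup>*\<^sup>* (init_state r) s"
  shows "sound K r \<beta> s"
  using assms(3)
  by (induction rule: rtranclp_induct) (auto intro: sound_init sound_step assms(1,2))

lemma no_infinite_run:
  assumes "run 0 = init_state r"
  shows "\<not> (\<forall>l. alg_step K r \<beta> (run l) (run (Suc l)))"
proof
  assume step: "\<forall>l. alg_step K r \<beta> (run l) (run (Suc l))"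
  have "tame (cand (run l))" for l
  proof (induction l)
    case 0
    show ?case using assms tame_init by simp
  next
    case (Suc l)
    then show ?case using step tame_step by blast
  qed
  then have "\<forall>l. (progress K r (run (Suc l)), progress K r (run l)) \<in> less_than <*lex*> less_than"
    using progress_step step by blast
  then have "\<exists>f. \<forall>l. (f (Suc l), f l) \<in> less_than <*lex*> less_than"
    by (rule exI[where x = "\<lambda>l. progress K r (run l)"])
  moreover have "wf (less_than <*lex*> less_than)" by auto
  ultimately show False unfolding wf_iff_no_infinite_down_chain by blast
qed

lemma step_exists:
  assumes "tame (cand s)" "cand s \<noteq> {}"
  shows "\<exists>s'. alg_step K r \<beta> s s'"
  using assms top_component_exists pseudo_optimal_exists
  unfolding alg_step_def tame_def by blast

lemma sound_final:
  assumes "sound K r \<beta> s" "cand s = {}"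
  shows "\<exists>d. d_out s = Some d \<and> eta_out s = ereal (mv_objective K r \<beta> d)
    \<and> mv_objective K r \<beta> d = Min (range (mv_objective K r \<beta>))"
proof -
  have le: "eta_out s \<le> ereal (mv_objective K r \<beta> d)" for d
    using assms unfolding sound_def by blast
  (* The objective values are finite, so the initial value infinity has been overwritten. *)
  obtain d where d: "d_out s = Some d"
    using assms(1) le[of undefined] by (cases "d_out s") (auto simp: sound_def)
  then have eta: "eta_out s = ereal (mv_objective K r \<beta> d)"
    using assms(1) by (simp add: sound_def)
  have "Min (range (mv_objective K r \<beta>)) = mv_objective K r \<beta> d"
    using le eta by (intro Min_eqI) auto
  then show ?thesis using d eta by simp
qed

theorem theorem1:
  fixes K :: "('s::finite, 'a::finite) kernel"
    and r :: "'s \<Rightarrow> 'a \<Rightarrow> real"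
    and \<beta> :: real
  assumes "unichain_mdp K"
    and "\<beta> \<ge> 0"
  shows "\<not> (\<exists>run. run 0 = init_state r \<and> (\<forall>l. alg_step K r \<beta> (run l) (run (Suc l))))
    \<and> (\<forall>s. (alg_step K r \<beta>)\<^sup>*\<^sup>* (init_state r) s \<and> cand s \<noteq> {}
         \<longrightarrow> (\<exists>s'. alg_step K r \<beta> s s'))
    \<and> (\<forall>s. (alg_step K r \<beta>)\<^sup>*\<^sup>* (init_state r) s \<and> cand s = {}
         \<longrightarrow> (\<exists>d. d_out s = Some d
               \<and> eta_out s = ereal (\<beta> * long_run_variance K r d - long_run_mean K r d)
               \<and> \<beta> * long_run_variance K r d - long_run_mean K r d
                 = Min (range (\<lambda>d'. \<beta> * long_run_variance K r d' - long_run_mean K r d'))))"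
  using no_infinite_run step_exists[OF reachable_tame]
    sound_final[OF reachable_sound[OF assms]]
  unfolding mv_objective_def[abs_def] by blast

end
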